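(* Let $s\ge 1$ and let $c_1,\dots,c_s\in\mathbb{R}$ be distinct collocation parameters satisfying $$\int_0^1\prod_{i=1}^s(\xi-c_i)\,d\xi=0.$$ Then the corresponding $s$-stage (collocation) GEPTRKN method has step order of accuracy $p=s+1$.
   Context: Problem: $y''(t)=f(t,y(t),y'(t))$, $y(t_0)=y_0$, $y'(t_0)=y_0'$ on $[t_0,t_0+T]$ (scalar form), where $f:[t_0,t_0+T]\times\mathbb{R}\times\mathbb{R}\to\mathbb{R}$, $f(t,y,z)$, is continuous in $t$ and Lipschitz in $(y,z)$, and $f$ and the exact solution $y$ are sufficiently smooth (i.e. have as many continuous derivatives as needed, the number depending only on $s$). All points at which $f$ and $y$ are evaluated are assumed to lie in the interval where they are defined. Notation: $\bm{c}=(c_1,\dots,c_s)^T$, $\bm{e}=(1,\dots,1)^T\in\mathbb{R}^s$; powers $\bm{c}^k$, $(\bm{c}-\bm{e})^k$ of vectors are componentwise (with zeroth power $\bm{e}$), and scalar functions are applied to vectors componentwise, e.g. $f(\bm{e}t+\bm{c}h,\bm{Y},\bm{Y}')=(f(t+c_ih,Y_i,Y_i'))_{i=1}^s$. GEPTRKN method: with step-size $h>0$, $t_{n+1}=t_n+h$, from $y_n\approx y(t_n)$, $y_n'\approx y'(t_n)$, $\bm{Y}_n\approx y(\bm{e}t_n+\bm{c}h)$, $\bm{Y}_n'\approx y'(\bm{e}t_n+\bm{c}h)$ one sets $F_n=f(\bm{e}t_n+\bm{c}h,\bm{Y}_n,\bm{Y}_n')$ and $$y_{n+1}=y_n+hy_n'+h^2\bm{b}^TF_n,\quad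 y'_{n+1}=y'_n+h\bm{d}^TF_n,$$ $$\bm{Y}_{n+1}=\bm{e}y_{n+1}+h\bm{c}y'_{n+1}+h^2\bm{A}F_n,\quad \bm{Y}'_{n+1}=\bm{e}y'_{n+1}+h\bm{B}F_n.$$ Here $\bm{b},\bm{d}\in\mathbb{R}^s$ and $\bm{A},\bm{B}\in\mathbb{R}^{s\times s}$ are the coefficients uniquely determined by the collocation conditions, for $k=0,\dots,s-1$: $$1=(k+2)(k+1)\bm{b}^T\bm{c}^k,\quad 1=(k+1)\bm{d}^T\bm{c}^k,\quad \bm{c}^{k+2}=(k+2)(k+1)\bm{A}(\bm{c}-\bm{e})^k,\quad \bm{c}^{k+1}=(k+1)\bm{B}(\bm{c}-\bm{e})^k.$$ Order: the method has step order $p=\min\{p_1,p_2\}$ and stage order $r=\min\{p_1,p_2,p_3,p_4\}$ if $y(t_{n+1})-y_{n+1}=O(h^{p_1+1})$, $y'(t_{n+1})-y'_{n+1}=O(h^{p_2+1})$, $y(\bm{e}t_{n+1}+\bm{c}h)-\bm{Y}_{n+1}=O(h^{p_3+1})$, $y'(\bm{e}t_{n+1}+\bm{c}h)-\bm{Y}'_{n+1}=O(h^{p_4+1})$ as $h\to0$, given that $y_n=y(t_n)+O(h^{p_1+1})$, $y'_n=y'(t_n)+O(h^{p_2+1})$, $y(\bm{e}t_n+\bm{c}h)-\bm{Y}_n=O(h^{p_3+1})$, $y'(\bm{e}t_n+\bm{c}h)-\bm{Y}'_n=O(h^{p_4+1})$. This is a one-step notion: the constants in the conclusion depend only on the problem,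 the method and the constants in the hypotheses. "Has order $q$" is understood in the sense that such estimates hold for some such $p_1,\dots,p_4$ (order at least $q$). *)

theory Defs
  imports "HOL-Analysis.Analysis"
begin

text \<open>
  Functions of class C-k on a set \<open>S\<close>: all directional derivatives of the Frechet derivative
  (relative to \<open>S\<close>) are of class C-(k-1).  Below, \<open>S\<close> is a nondegenerate interval, or its product
  with a Euclidean space, so derivatives relative to \<open>S\<close> are unique (one-sided at the endpoints).
\<close>

primrec Ck_on :: "nat \<Rightarrow> ('a::euclidean_space \<Rightarrow> 'b::real_normed_vector) \<Rightarrow> 'a set \<Rightarrow> bool" where
  "Ck_on 0 f S \<longleftrightarrow> continuous_on S f"
| "Ck_on (Suc k) f S \<longleftrightarrow>
     (\<exists>f'. (\<forall>x\<in>S. (f has_derivative f' x) (at x within S)) \<and> (\<forall>v. Ck_on k (\<lambda>x. f' x v) S))"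

definition admissible_rhs :: "nat \<Rightarrow> real \<Rightarrow> real \<Rightarrow> (real \<Rightarrow> real \<Rightarrow> real \<Rightarrow> real) \<Rightarrow> bool" where
  "admissible_rhs N t0 T f \<longleftrightarrow>
     (\<forall>u v. continuous_on {t0..t0 + T} (\<lambda>t. f t u v)) \<and>
     (\<exists>L. \<forall>t\<in>{t0..t0 + T}. L-lipschitz_on UNIV (\<lambda>(u, v). f t u v)) \<and>
     Ck_on N (\<lambda>(t, u, v). f t u v) ({t0..t0 + T} \<times> UNIV \<times> UNIV)"

definition solves_ivp ::
  "real \<Rightarrow> real \<Rightarrow> (real \<Rightarrow> real \<Rightarrow> real \<Rightarrow> real) \<Rightarrow> real \<Rightarrow> real \<Rightarrow> (real \<Rightarrow> real) \<Rightarrow> (real \<Rightarrow> real) \<Rightarrow> bool" where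
  "solves_ivp t0 T f y0 y0' y y' \<longleftrightarrow>
     (\<forall>t\<in>{t0..t0 + T}. (y has_real_derivative y' t) (at t within {t0..t0 + T}) \<and>
                        (y' has_real_derivative f t (y t) (y' t)) (at t within {t0..t0 + T})) \<and>
     y t0 = y0 \<and> y' t0 = y0'"

text \<open>
  In the ring \<open>real^'s\<close> multiplication and powers are componentwise and \<open>1\<close> is the all-ones vector.
\<close>

definition geptrkn_collocation ::
  "real^'s \<Rightarrow> real^'s \<Rightarrow> real^'s \<Rightarrow> real^'s^'s \<Rightarrow> real^'s^'s \<Rightarrow> bool" where
  "geptrkn_collocation c b d A B \<longleftrightarrow>
     (\<forall>k<CARD('s).
        1 = real (k + 2) * real (k + 1) * (b \<bullet> c ^ k) \<and>
        1 = real (k + 1) * (d \<bullet> c ^ k) \<and>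
        c ^ (k + 2) = (real (k + 2) * real (k + 1)) *\<^sub>R (A *v (c - 1) ^ k) \<and>
        c ^ (k + 1) = real (k + 1) *\<^sub>R (B *v (c - 1) ^ k))"

text \<open>Numerical data at a step point: the values \<open>(y, y', Y, Y')\<close>.\<close>

type_synonym 's step_data = "real \<times> real \<times> (real^'s) \<times> (real^'s)"

definition geptrkn_step ::
  "(real \<Rightarrow> real \<Rightarrow> real \<Rightarrow> real) \<Rightarrow> real^'s \<Rightarrow> real^'s \<Rightarrow> real^'s \<Rightarrow> real^'s^'s \<Rightarrow> real^'s^'s \<Rightarrow>
   real \<Rightarrow> real \<Rightarrow> 's step_data \<Rightarrow> 's step_data" where
  "geptrkn_step f c b d A B h t = (\<lambda>(u, u', U, U').
     let F = (\<chi> i. f (t + c $ i * h) (U $ i) (U' $ i));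
         v = u + h * u' + h\<^sup>2 * (b \<bullet> F);
         v' = u' + h * (d \<bullet> F)
     in (v, v',
         v *\<^sub>R 1 + (h * v') *\<^sub>R c + h\<^sup>2 *\<^sub>R (A *v F),
         v' *\<^sub>R 1 + h *\<^sub>R (B *v F)))"

definition errors_le ::
  "real \<Rightarrow> nat \<Rightarrow> nat \<Rightarrow> nat \<Rightarrow> nat \<Rightarrow> real^'s \<Rightarrow> (real \<Rightarrow> real) \<Rightarrow> (real \<Rightarrow> real) \<Rightarrow>
   real \<Rightarrow> real \<Rightarrow> 's step_data \<Rightarrow> bool" where
  "errors_le C p1 p2 p3 p4 c y y' h t = (\<lambda>(u, u', U, U').
     \<bar>y t - u\<bar> \<le> C * h ^ (p1 + 1) \<and>
     \<bar>y' t - u'\<bar> \<le> C * h ^ (p2 + 1) \<and>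
     norm ((\<chi> i. y (t + c $ i * h)) - U) \<le> C * h ^ (p3 + 1) \<and>
     norm ((\<chi> i. y' (t + c $ i * h)) - U') \<le> C * h ^ (p4 + 1))"

text \<open>
  The method has step order \<open>q\<close> for problems with \<open>N\<close> continuous derivatives.  The one-step estimates
  are uniform: the constant \<open>K\<close> and the range of step-sizes depend only on the method, the problem and
  the constant \<open>C\<close> bounding the errors of the input data, not on the step point \<open>t\<close> or on the data.
  Only steps all of whose evaluation points lie in the interval of definition are considered.
  Sharpness is not required, so this means order at least \<open>q\<close>.
\<close>

definition geptrkn_step_order ::
  "nat \<Rightarrow> real^'s \<Rightarrow> real^'s \<Rightarrow> real^'s \<Rightarrow> real^'s^'s \<Rightarrow> real^'s^'s \<Rightarrow> nat \<Rightarrow> bool" where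
  "geptrkn_step_order N c b d A B q \<longleftrightarrow>
     (\<exists>p1 p2 p3 p4. q = min p1 p2 \<and>
        (\<forall>t0 T f y0 y0' y y'.
           T > 0 \<and> admissible_rhs N t0 T f \<and> solves_ivp t0 T f y0 y0' y y' \<and>
           Ck_on N y {t0..t0 + T} \<longrightarrow>
           (\<forall>C. \<exists>K. \<forall>\<^sub>F h in at_right 0. \<forall>t w.
              {t, t + h} \<subseteq> {t0..t0 + T} \<and>
              (\<forall>i. {t + c $ i * h, t + h + c $ i * h} \<subseteq> {t0..t0 + T}) \<and>
              errors_le C p1 p2 p3 p4 c y y' h t w \<longrightarrow>
              errors_le K p1 p2 p3 p4 c y y' h (t + h) (geptrkn_step f c b d A B h t w))))"

end

theory Submission
  imports Defs "HOL-Computational_Algebra.Polynomial"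
begin

text \<open>
  Write \<open>s\<close> for the number of stages.  The exponents are chosen as \<open>p1 = p2 = s + 1\<close> and
  \<open>p3 = p4 = s\<close>: step values are accurate to \<open>O(h ^ (s + 2))\<close>, stage values only to
  \<open>O(h ^ (s + 1))\<close>.

  The error of each updated quantity splits into three parts: errors inherited from other values of
  \<open>y\<close> and \<open>y'\<close>, the defect left when the exact solution is inserted into the formula, and the effect
  of evaluating \<open>f\<close> at perturbed stages.  By the Lipschitz condition the last part is
  \<open>O(h ^ (s + 1))\<close> before it is multiplied by \<open>h\<close> or \<open>h\<^sup>2\<close>, so it is always small enough.

  Every formula replaces the integration of \<open>y''\<close>, once (\<open>m = 1\<close>) or twice (\<open>m = 2\<close>), by a weighted sum
  of values of \<open>y''\<close>, and collocation makes this exact on polynomials of degree below \<open>s\<close>.  The defect is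
  therefore \<open>O(h ^ (s + m))\<close> (lemma \<open>integration_formula_defect\<close>).  This suffices for the formulas with \<open>b\<close>, \<open>A\<close>
  and \<open>B\<close>, but for \<open>d\<close>, where \<open>m = 1\<close> and \<open>O(h ^ (s + 2))\<close> is needed, it is one power short.
  Here the integral hypothesis enters: the quadrature formula with weights \<open>d\<close> gains one degree of
  exactness because its node polynomial has integral zero
  (lemma \<open>extra_moment_of_node_orthogonality\<close>).  Lemma \<open>geptrkn_one_step_errors\<close> combines the parts.

  The constants are uniform in the step point because the derivatives of \<open>y\<close> in the remainders are
  continuous on a compact interval.
\<close>

section \<open>Smooth functions and Taylor expansion on an interval\<close>

text \<open>
  Evaluating the Frechet derivative in direction \<open>1\<close> turns C-k regularity on the line into a tower
  of ordinary derivatives, the form in which Taylor's theorem consumes it.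
\<close>

lemma Ck_on_derivative_tower:
  fixes f :: "real \<Rightarrow> real"
  assumes "Ck_on n f S"
  obtains g where "g 0 = f"
    and "\<And>j x. j < n \<Longrightarrow> x \<in> S \<Longrightarrow> (g j has_real_derivative g (Suc j) x) (at x within S)"
    and "\<And>j. j \<le> n \<Longrightarrow> continuous_on S (g j)"
proof -
  have "\<exists>g. g 0 = f \<and>
      (\<forall>j<n. \<forall>x\<in>S. (g j has_real_derivative g (Suc j) x) (at x within S)) \<and>
      continuous_on S (g n)"
    using assms
  proof (induction n arbitrary: f)
    case 0
    then show ?case by (intro exI[of _ "\<lambda>_. f"]) simp
  next
    case (Suc n)
    then obtain f' where f': "\<And>x. x \<in> S \<Longrightarrow> (f has_derivative f' x) (at x within S)"
      and "\<And>v. Ck_on n (\<lambda>x. f' x v) S"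
      unfolding Ck_on.simps by blast
    then obtain g where g: "g 0 = (\<lambda>x. f' x 1)"
      "\<And>j x. j < n \<Longrightarrow> x \<in> S \<Longrightarrow> (g j has_real_derivative g (Suc j) x) (at x within S)"
      "continuous_on S (g n)"
      using Suc.IH by metis
    have D: "(f has_real_derivative f' x 1) (at x within S)" if "x \<in> S" for x
    proof (rule has_derivative_imp_has_field_derivative[OF f'[OF that]])
      fix v :: real
      show "v * f' x 1 = f' x v"
        using linear_cmul[OF has_derivative_linear[OF f'[OF that]], of v 1] by simp
    qed
    have "((case_nat f g) j has_real_derivative (case_nat f g) (Suc j) x) (at x within S)"
      if "j < Suc n" "x \<in> S" for j x
      using that D g by (cases j) auto
    then show ?case
      using g(3) by (intro exI[of _ "case_nat f g"]) auto
  qed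
  then obtain g where g: "g 0 = f"
      "\<And>j x. j < n \<Longrightarrow> x \<in> S \<Longrightarrow> (g j has_real_derivative g (Suc j) x) (at x within S)"
      "continuous_on S (g n)"
    by blast
  have "continuous_on S (g j)" if "j \<le> n" for j
  proof (cases "j = n")
    case False
    then show ?thesis
      using that g(2)[of j] by (intro DERIV_continuous_on[of S "g j" "g (Suc j)"]) auto
  qed (use g in simp)
  with g(1,2) show thesis by (rule that)
qed

lemma real_derivative_unique_within_interval:
  fixes f :: "real \<Rightarrow> real"
  assumes "a < b" "x \<in> {a..b}"
    and "(f has_real_derivative D) (at x within {a..b})"
    and "(f has_real_derivative E) (at x within {a..b})"
  shows "D = E"
  using vector_derivative_unique_within_closed_interval[of a b x f D E] assms
  by (simp add: has_real_derivative_iff_has_vector_derivative)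

text \<open>
  Dropping the factorial from the remainder lets one bound cover all orders, including order \<open>0\<close>.
\<close>

lemma Taylor_remainder_bound:
  fixes g :: "nat \<Rightarrow> real \<Rightarrow> real"
  assumes "convex S"
    and "\<And>j x. j < n \<Longrightarrow> x \<in> S \<Longrightarrow> (g j has_real_derivative g (Suc j) x) (at x within S)"
    and "\<And>x. x \<in> S \<Longrightarrow> \<bar>g n x\<bar> \<le> M"
    and "x \<in> S" "x + v \<in> S"
  shows "\<bar>g 0 (x + v) - (\<Sum>k<n. g k x * v ^ k / fact k)\<bar> \<le> M * \<bar>v\<bar> ^ n"
proof (cases n)
  case 0
  then show ?thesis using assms by simp
next
  case (Suc m)
  have "M \<ge> 0" using assms(3)[OF assms(4)] by linarith
  have "\<bar>g 0 (x + v) - (\<Sum>k\<le>m. g k x * v ^ k / fact k)\<bar> \<le> M * \<bar>v\<bar> ^ Suc m / fact m"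
    using field_Taylor[of S m g M x "x + v"] assms Suc by simp
  also have "\<dots> \<le> M * \<bar>v\<bar> ^ Suc m / 1"
    using \<open>M \<ge> 0\<close> by (intro divide_left_mono) auto
  finally show ?thesis by (simp add: Suc lessThan_Suc_atMost)
qed

section \<open>Defects of the collocation formulas\<close>

lemma vec_power_component: "(x ^ n) $ i = (x $ i) ^ n" for x :: "real^'s"
  by (induction n) auto

definition defect_const :: "real^'s \<Rightarrow> real^'s \<Rightarrow> real \<Rightarrow> nat \<Rightarrow> nat \<Rightarrow> real" where
  "defect_const w x \<theta> m n = \<bar>\<theta>\<bar> ^ (n + m) + (\<Sum>i\<in>UNIV. \<bar>w $ i\<bar> * \<bar>x $ i\<bar> ^ n)"

lemma defect_const_nonneg: "defect_const w x \<theta> m n \<ge> 0"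
  unfolding defect_const_def by (intro add_nonneg_nonneg sum_nonneg) auto

text \<open>
  The moment conditions say that \<open>m\<close>-fold integration over \<open>[0, \<theta>]\<close> is reproduced by the weights \<open>w\<close>
  at the nodes \<open>x\<close> on polynomials of degree below \<open>n\<close>.  So in the Taylor expansions at \<open>t\<close> of
  \<open>g 0 (t + \<theta> h)\<close> up to degree \<open>n + m\<close>, and of the values of \<open>g m\<close> at the nodes up to degree \<open>n\<close>,
  all polynomial terms cancel and only the two remainders survive.  Every
  formula of the method is an instance: the weights are \<open>b\<close>, \<open>d\<close> or a row of \<open>A\<close> or \<open>B\<close>, with \<open>m = 2\<close>
  for formulas that produce values of \<open>y\<close> and \<open>m = 1\<close> for those that produce values of \<open>y'\<close>.
\<close>

lemma integration_formula_defect: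
  fixes g :: "nat \<Rightarrow> real \<Rightarrow> real" and w x :: "real^'s"
  assumes "convex S"
    and deriv: "\<And>j z. j < n + m \<Longrightarrow> z \<in> S \<Longrightarrow> (g j has_real_derivative g (Suc j) z) (at z within S)"
    and bound: "\<And>z. z \<in> S \<Longrightarrow> \<bar>g (n + m) z\<bar> \<le> M"
    and moments: "\<And>k. k < n \<Longrightarrow> fact (k + m) * (w \<bullet> x ^ k) = fact k * \<theta> ^ (k + m)"
    and h: "h \<ge> 0" and "t \<in> S" "t + \<theta> * h \<in> S" "\<And>i. t + x $ i * h \<in> S"
  shows "\<bar>g 0 (t + \<theta> * h) - (\<Sum>k<m. g k t * (\<theta> * h) ^ k / fact k) -
          h ^ m * (w \<bullet> (\<chi> i. g m (t + x $ i * h)))\<bar> \<le> M * defect_const w x \<theta> m n * h ^ (n + m)"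
proof -
  define R where "R = g 0 (t + \<theta> * h) - (\<Sum>k<n + m. g k t * (\<theta> * h) ^ k / fact k)"
  define r where "r i = g m (t + x $ i * h) - (\<Sum>k<n. g (k + m) t * (x $ i * h) ^ k / fact k)" for i
  have R: "\<bar>R\<bar> \<le> M * \<bar>\<theta> * h\<bar> ^ (n + m)"
    unfolding R_def using assms by (intro Taylor_remainder_bound[of S]) auto
  have r: "\<bar>r i\<bar> \<le> M * \<bar>x $ i * h\<bar> ^ n" for i
    unfolding r_def
    using Taylor_remainder_bound[of S n "\<lambda>k. g (k + m)" M t "x $ i * h"] assms by simp
  have moment_term: "h ^ m * (\<Sum>i\<in>UNIV. w $ i * (g (k + m) t * (x $ i * h) ^ k / fact k)) =
      g (k + m) t * (\<theta> * h) ^ (k + m) / fact (k + m)" if "k < n" for k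
  proof -
    have "h ^ m * (\<Sum>i\<in>UNIV. w $ i * (g (k + m) t * (x $ i * h) ^ k / fact k)) =
        g (k + m) t * h ^ (k + m) / fact k * (w \<bullet> x ^ k)"
      by (simp add: inner_vec_def vec_power_component sum_distrib_left sum_divide_distrib
          power_mult_distrib power_add mult_ac)
    also have "w \<bullet> x ^ k = fact k * \<theta> ^ (k + m) / fact (k + m)"
      using moments[OF that] by (simp add: field_simps)
    finally show ?thesis by (simp add: power_mult_distrib mult_ac)
  qed
  have "h ^ m * (w \<bullet> (\<chi> i. g m (t + x $ i * h))) =
      h ^ m * (\<Sum>i\<in>UNIV. \<Sum>k<n. w $ i * (g (k + m) t * (x $ i * h) ^ k / fact k)) +
      h ^ m * (\<Sum>i\<in>UNIV. w $ i * r i)"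
    by (simp add: inner_vec_def r_def right_diff_distrib sum_subtractf sum_distrib_left)
  also have "(\<Sum>i\<in>UNIV. \<Sum>k<n. w $ i * (g (k + m) t * (x $ i * h) ^ k / fact k)) =
      (\<Sum>k<n. \<Sum>i\<in>UNIV. w $ i * (g (k + m) t * (x $ i * h) ^ k / fact k))"
    by (rule sum.swap)
  also have "h ^ m * \<dots> = (\<Sum>k<n. g (k + m) t * (\<theta> * h) ^ (k + m) / fact (k + m))"
    by (subst sum_distrib_left) (intro sum.cong refl moment_term, simp)
  also have "\<dots> = (\<Sum>k<n + m. g k t * (\<theta> * h) ^ k / fact k) - (\<Sum>k<m. g k t * (\<theta> * h) ^ k / fact k)"
    by (induction n) auto
  finally have "g 0 (t + \<theta> * h) - (\<Sum>k<m. g k t * (\<theta> * h) ^ k / fact k) -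
      h ^ m * (w \<bullet> (\<chi> i. g m (t + x $ i * h))) = R - h ^ m * (\<Sum>i\<in>UNIV. w $ i * r i)"
    by (simp add: R_def)
  also have "\<bar>\<dots>\<bar> \<le> \<bar>R\<bar> + h ^ m * (\<Sum>i\<in>UNIV. \<bar>w $ i\<bar> * \<bar>r i\<bar>)"
  proof -
    have "\<bar>\<Sum>i\<in>UNIV. w $ i * r i\<bar> \<le> (\<Sum>i\<in>UNIV. \<bar>w $ i\<bar> * \<bar>r i\<bar>)"
      using sum_abs[of "\<lambda>i. w $ i * r i" UNIV] by (simp add: abs_mult)
    then have "\<bar>h ^ m * (\<Sum>i\<in>UNIV. w $ i * r i)\<bar> \<le> h ^ m * (\<Sum>i\<in>UNIV. \<bar>w $ i\<bar> * \<bar>r i\<bar>)"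
      using h by (simp add: abs_mult mult_left_mono)
    then show ?thesis by linarith
  qed
  also have "\<dots> \<le> M * \<bar>\<theta> * h\<bar> ^ (n + m) +
      h ^ m * (\<Sum>i\<in>UNIV. \<bar>w $ i\<bar> * (M * \<bar>x $ i * h\<bar> ^ n))"
    using R r h by (intro add_mono mult_left_mono sum_mono) auto
  also have "\<dots> = M * defect_const w x \<theta> m n * h ^ (n + m)"
    using h by (simp add: defect_const_def abs_mult power_mult_distrib power_add distrib_left
        distrib_right sum_distrib_left sum_distrib_right mult_ac)
  finally show ?thesis .
qed

text \<open>
  The monic node polynomial \<open>q\<close> vanishes at all nodes, so the formula gives it the value \<open>0\<close>, which by
  hypothesis is also its integral.  Since the formula is exact on all lower powers, it must be exact
  on the leading power of \<open>q\<close> as well.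
\<close>

lemma extra_moment_of_node_orthogonality:
  fixes c d :: "real^'s"
  assumes int: "integral {0..1} (\<lambda>\<xi>. \<Prod>i\<in>UNIV. \<xi> - c $ i) = 0"
    and d: "\<And>k. k < CARD('s) \<Longrightarrow> real (k + 1) * (d \<bullet> c ^ k) = 1"
  shows "real (CARD('s) + 1) * (d \<bullet> c ^ CARD('s)) = 1"
proof -
  define q where "q = (\<Prod>i\<in>UNIV. [:- c $ i, 1:])"
  have deg: "degree q = CARD('s)"
    unfolding q_def by (subst degree_prod_eq_sum_degree) auto
  have monic: "coeff q (CARD('s)) = 1"
    using lead_coeff_prod[of "\<lambda>i. [:- c $ i, 1:]" UNIV] by (simp add: q_def[symmetric] deg)
  have poly_q: "poly q x = (\<Prod>i\<in>UNIV. x - c $ i)" for x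
    by (simp add: q_def poly_prod)
  have expand: "poly q x = (\<Sum>k\<le>CARD('s). coeff q k * x ^ k)" for x
    by (simp add: poly_altdef deg)
  have powers: "((\<lambda>\<xi>. coeff q k * \<xi> ^ k) has_integral coeff q k * (1 / real (k + 1))) {0..1}" for k
  proof (rule has_integral_mult_right)
    have "((\<lambda>\<xi>::real. \<xi> ^ k) has_integral (1 ^ Suc k / real (Suc k) - 0 ^ Suc k / real (Suc k))) {0..1}"
    proof (rule fundamental_theorem_of_calculus)
      fix x :: real
      have "((\<lambda>\<xi>. \<xi> ^ Suc k / real (Suc k)) has_real_derivative x ^ k) (at x within {0..1})"
        using DERIV_cdivide[OF DERIV_pow[of "Suc k" x "{0..1}"], of "real (Suc k)"] by simp
      then show "((\<lambda>\<xi>. \<xi> ^ Suc k / real (Suc k)) has_vector_derivative x ^ k) (at x within {0..1})"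
        by (simp add: has_real_derivative_iff_has_vector_derivative)
    qed simp
    then show "((\<lambda>\<xi>::real. \<xi> ^ k) has_integral 1 / real (k + 1)) {0..1}"
      by simp
  qed
  have "(poly q has_integral (\<Sum>k\<le>CARD('s). coeff q k * (1 / real (k + 1)))) {0..1}"
    unfolding expand using powers by (intro has_integral_sum) auto
  then have "(\<Sum>k\<le>CARD('s). coeff q k * (1 / real (k + 1))) = 0"
    using int integral_unique unfolding poly_q[symmetric] by metis
  then have integral_zero: "(\<Sum>k<CARD('s). coeff q k * (1 / real (k + 1))) + 1 / real (CARD('s) + 1) = 0"
    by (simp add: lessThan_Suc_atMost[symmetric] monic)
  have "0 = (\<Sum>i\<in>UNIV. d $ i * poly q (c $ i))"
  proof -
    have "poly q (c $ i) = 0" for i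
      unfolding poly_q by (rule prod_zero) auto
    then show ?thesis by simp
  qed
  also have "\<dots> = (\<Sum>k\<le>CARD('s). coeff q k * (d \<bullet> c ^ k))"
    unfolding expand sum_distrib_left inner_vec_def vec_power_component
    by (subst sum.swap) (simp add: mult_ac)
  also have "\<dots> = (\<Sum>k<CARD('s). coeff q k * (d \<bullet> c ^ k)) + d \<bullet> c ^ CARD('s)"
    by (simp add: lessThan_Suc_atMost[symmetric] monic)
  also have "(\<Sum>k<CARD('s). coeff q k * (d \<bullet> c ^ k)) = (\<Sum>k<CARD('s). coeff q k * (1 / real (k + 1)))"
  proof (rule sum.cong)
    fix k assume "k \<in> {..<CARD('s)}"
    then show "coeff q k * (d \<bullet> c ^ k) = coeff q k * (1 / real (k + 1))"
      using d[of k] by (simp add: field_simps)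
  qed simp
  finally have "d \<bullet> c ^ CARD('s) = 1 / real (CARD('s) + 1)"
    using integral_zero by simp
  then show ?thesis by simp
qed

section \<open>Error propagation in one step\<close>

text \<open>
  Old stage errors enter only through \<open>f\<close>, and \<open>f\<close> enters every update with a factor \<open>h\<close> at least.  That
  factor makes up for the stages being one order less accurate than the step values.  The new
  stages are built from the new step values, so these have to be estimated before them.
\<close>

lemma geptrkn_one_step_errors:
  fixes c b d :: "real^'s" and A B :: "real^'s^'s" and g :: "nat \<Rightarrow> real \<Rightarrow> real"
  defines "s \<equiv> CARD('s)"
  assumes coll: "geptrkn_collocation c b d A B"
    and extra: "real (s + 1) * (d \<bullet> c ^ s) = 1"
    and S: "convex S"
    and deriv: "\<And>j z. j < s + 3 \<Longrightarrow> z \<in> S \<Longrightarrow> (g j has_real_derivative g (Suc j) z) (at z within S)"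
    and bound: "\<And>j z. j \<le> s + 3 \<Longrightarrow> z \<in> S \<Longrightarrow> \<bar>g j z\<bar> \<le> M"
    and rhs: "\<And>z. z \<in> S \<Longrightarrow> g 2 z = f z (g 0 z) (g 1 z)"
    and lip: "\<And>z. z \<in> S \<Longrightarrow> L-lipschitz_on UNIV (\<lambda>(u, v). f z u v)"
  obtains K where "\<And>h t w. \<lbrakk>0 < h; h \<le> 1; t \<in> S; t + h \<in> S;
      \<And>i. t + c $ i * h \<in> S; \<And>i. t + h + c $ i * h \<in> S;
      errors_le C (s + 1) (s + 1) s s c (g 0) (g 1) h t w\<rbrakk> \<Longrightarrow>
      errors_le K (s + 1) (s + 1) s s c (g 0) (g 1) h (t + h) (geptrkn_step f c b d A B h t w)"
proof -
  \<comment> \<open>\<open>E\<close> bounds the perturbation of the vector of \<open>f\<close>-values.  Absolute values of \<open>C\<close> and \<open>M\<close> keep all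
    constants nonnegative, so that larger powers of \<open>h\<close> can be absorbed into smaller ones.\<close>
  define E where "E = real s * (L * (2 * \<bar>C\<bar>))"
  define Kv where "Kv = 2 * \<bar>C\<bar> + \<bar>M\<bar> * defect_const b c 1 2 s + norm b * E"
  define Kv' where "Kv' = \<bar>C\<bar> + \<bar>M\<bar> * defect_const d c 1 1 (s + 1) + norm d * E"
  define KV where "KV i = Kv + \<bar>c $ i\<bar> * Kv' + \<bar>M\<bar> * defect_const (A $ i) (c - 1) (c $ i) 2 s +
      norm (A $ i) * E" for i
  define KV' where "KV' i = Kv' + \<bar>M\<bar> * defect_const (B $ i) (c - 1) (c $ i) 1 s +
      norm (B $ i) * E" for i
  define K where "K = Kv + Kv' + (\<Sum>i\<in>UNIV. KV i) + (\<Sum>i\<in>UNIV. KV' i)"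
  have "errors_le K (s + 1) (s + 1) s s c (g 0) (g 1) h (t + h) (geptrkn_step f c b d A B h t w)"
    if h: "0 < h" "h \<le> 1" and t: "t \<in> S" "t + h \<in> S"
      and nodes: "\<And>i. t + c $ i * h \<in> S" "\<And>i. t + h + c $ i * h \<in> S"
      and err: "errors_le C (s + 1) (s + 1) s s c (g 0) (g 1) h t w" for h t w
  proof -
    obtain u u' U U' where w: "w = (u, u', U, U')" by (cases w) auto
    \<comment> \<open>All estimates are in terms of \<open>H\<close>, the stage accuracy, and \<open>h * H\<close>, the step accuracy.\<close>
    define H where "H = h ^ (s + 1)"
    define F where "F = (\<chi> i. f (t + c $ i * h) (U $ i) (U' $ i))"
    define X where "X = (\<chi> i. g 2 (t + c $ i * h))"
    define v where "v = u + h * u' + h\<^sup>2 * (b \<bullet> F)"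
    define v' where "v' = u' + h * (d \<bullet> F)"
    define V where "V = v *\<^sub>R 1 + (h * v') *\<^sub>R c + h\<^sup>2 *\<^sub>R (A *v F)"
    define V' where "V' = v' *\<^sub>R 1 + h *\<^sub>R (B *v F)"
    have step: "geptrkn_step f c b d A B h t w = (v, v', V, V')"
      by (simp add: geptrkn_step_def w Let_def F_def v_def v'_def V_def V'_def)
    have L: "L \<ge> 0" using lip[OF t(1)] by (rule lipschitz_on_nonneg)
    have E: "E \<ge> 0" using L by (simp add: E_def)
    have K_nonneg: "Kv \<ge> 0" "Kv' \<ge> 0" "\<And>i. KV i \<ge> 0" "\<And>i. KV' i \<ge> 0"
      using E by (simp_all add: Kv_def Kv'_def KV_def KV'_def defect_const_nonneg)
    have H: "H > 0" using h by (simp add: H_def)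
    have hH: "h * H \<le> H" "h * (h * H) \<le> h * H"
      using h H mult_right_mono[of h 1 H] mult_right_mono[of h 1 "h * H"] by auto
    have C: "x * H \<le> \<bar>C\<bar> * H" "x * (h * H) \<le> \<bar>C\<bar> * (h * H)" if "x \<le> C" for x
      using that h H by (auto intro!: mult_right_mono)
    have in_err: "\<bar>g 0 t - u\<bar> \<le> \<bar>C\<bar> * (h * H)" "\<bar>g 1 t - u'\<bar> \<le> \<bar>C\<bar> * (h * H)"
      "norm ((\<chi> i. g 0 (t + c $ i * h)) - U) \<le> \<bar>C\<bar> * H"
      "norm ((\<chi> i. g 1 (t + c $ i * h)) - U') \<le> \<bar>C\<bar> * H"
      using err C[of C] by (auto simp: errors_le_def w H_def mult_ac)

    have F_err: "norm (X - F) \<le> E * H"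
    proof -
      have "\<bar>(X - F) $ i\<bar> \<le> L * (2 * \<bar>C\<bar>) * H" for i
      proof -
        let ?z = "t + c $ i * h"
        have "\<bar>(X - F) $ i\<bar> = dist (f ?z (g 0 ?z) (g 1 ?z)) (f ?z (U $ i) (U' $ i))"
          by (simp add: X_def F_def dist_real_def rhs[OF nodes(1)])
        also have "\<dots> \<le> L * dist (g 0 ?z, g 1 ?z) (U $ i, U' $ i)"
          using lipschitz_onD[OF lip[OF nodes(1)], of "(g 0 ?z, g 1 ?z)" "(U $ i, U' $ i)" i] by simp
        also have "dist (g 0 ?z, g 1 ?z) (U $ i, U' $ i) \<le> \<bar>g 0 ?z - U $ i\<bar> + \<bar>g 1 ?z - U' $ i\<bar>"
          using norm_Pair_le[of "g 0 ?z - U $ i" "g 1 ?z - U' $ i"] by (simp add: dist_norm)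
        also have "\<dots> \<le> \<bar>C\<bar> * H + \<bar>C\<bar> * H"
          using order.trans[OF component_le_norm_cart in_err(3), of i]
            order.trans[OF component_le_norm_cart in_err(4), of i]
          by (intro add_mono) simp_all
        finally show ?thesis using L by (simp only: mult_left_mono) (simp add: algebra_simps)
      qed
      then have "(\<Sum>i\<in>UNIV. \<bar>(X - F) $ i\<bar>) \<le> (\<Sum>i\<in>(UNIV :: 's set). L * (2 * \<bar>C\<bar>) * H)"
        by (intro sum_mono)
      then show ?thesis
        using norm_le_l1_cart[of "X - F"] by (simp add: E_def s_def)
    qed
    have weighted_F_err: "\<bar>a \<bullet> (X - F)\<bar> \<le> norm a * E * H" for a :: "real^'s"
      using Cauchy_Schwarz_ineq2[of a "X - F"] mult_left_mono[OF F_err, of "norm a"] by simp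

    have defect: "\<bar>g j (z + \<theta> * h) - (\<Sum>k<m. g (k + j) z * (\<theta> * h) ^ k / fact k) -
          h ^ m * (a \<bullet> (\<chi> i. g (m + j) (z + x $ i * h)))\<bar> \<le> \<bar>M\<bar> * defect_const a x \<theta> m n * h ^ (n + m)"
      if "\<And>k. k < n \<Longrightarrow> fact (k + m) * (a \<bullet> x ^ k) = fact k * \<theta> ^ (k + m)"
        and "n + m + j \<le> s + 3" "z \<in> S" "z + \<theta> * h \<in> S" "\<And>i. z + x $ i * h \<in> S"
      for a x :: "real^'s" and \<theta> z j m n
    proof -
      have "\<bar>g i z'\<bar> \<le> \<bar>M\<bar>" if "i \<le> s + 3" "z' \<in> S" for i z'
        using bound[OF that] by simp
      then show ?thesis
        using integration_formula_defect[of S n m "\<lambda>i. g (i + j)" "\<bar>M\<bar>" a x \<theta> h z] S deriv h that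
        by simp
    qed
    \<comment> \<open>For the stage formulas the Taylor expansions are centred at \<open>t + h\<close>, as seen from which the old stages
      sit at the nodes \<open>c - 1\<close>.\<close>
    have shift: "t + h + (c - 1) $ i * h = t + c $ i * h" for i
      by (simp add: algebra_simps)
    have fact2: "fact (k + 2) = real (k + 2) * real (k + 1) * fact k" for k
      by (simp add: algebra_simps)
    have fact1: "fact (k + 1) = real (k + 1) * fact k" for k
      by simp
    have coll_b: "real (k + 2) * real (k + 1) * (b \<bullet> c ^ k) = 1"
      and coll_d: "real (k + 1) * (d \<bullet> c ^ k) = 1"
      and coll_A: "real (k + 2) * real (k + 1) * (A $ i \<bullet> (c - 1) ^ k) = c $ i ^ (k + 2)"
      and coll_B: "real (k + 1) * (B $ i \<bullet> (c - 1) ^ k) = c $ i ^ (k + 1)"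
      if "k < s" for k i
    proof -
      have eqs: "1 = real (k + 2) * real (k + 1) * (b \<bullet> c ^ k)" "1 = real (k + 1) * (d \<bullet> c ^ k)"
        "c ^ (k + 2) = (real (k + 2) * real (k + 1)) *\<^sub>R (A *v (c - 1) ^ k)"
        "c ^ (k + 1) = real (k + 1) *\<^sub>R (B *v (c - 1) ^ k)"
        using coll that unfolding geptrkn_collocation_def s_def by blast+
      show "real (k + 2) * real (k + 1) * (b \<bullet> c ^ k) = 1" "real (k + 1) * (d \<bullet> c ^ k) = 1"
        using eqs(1,2) by simp_all
      show "real (k + 2) * real (k + 1) * (A $ i \<bullet> (c - 1) ^ k) = c $ i ^ (k + 2)"
        using arg_cong[OF eqs(3), of "\<lambda>x. x $ i"]
        by (simp only: vec_power_component vector_scaleR_component matrix_vector_mul_component real_scaleR_def)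
      show "real (k + 1) * (B $ i \<bullet> (c - 1) ^ k) = c $ i ^ (k + 1)"
        using arg_cong[OF eqs(4), of "\<lambda>x. x $ i"]
        by (simp only: vec_power_component vector_scaleR_component matrix_vector_mul_component real_scaleR_def)
    qed
    have coll_d': "real (k + 1) * (d \<bullet> c ^ k) = 1" if "k < s + 1" for k
      using that coll_d extra by (cases "k = s") auto

    have b_defect: "\<bar>g 0 (t + h) - (g 0 t + h * g 1 t) - h\<^sup>2 * (b \<bullet> X)\<bar> \<le>
        \<bar>M\<bar> * defect_const b c 1 2 s * (h * H)"
    proof -
      have "fact (k + 2) * (b \<bullet> c ^ k) = fact k * 1 ^ (k + 2)" if "k < s" for k
        using coll_b[OF that] unfolding fact2 by simp
      from defect[OF this, where n = s and j = 0 and z = t] t nodes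
      show ?thesis by (simp add: X_def H_def numeral_2_eq_2 algebra_simps)
    qed
    have d_defect: "\<bar>g 1 (t + h) - g 1 t - h * (d \<bullet> X)\<bar> \<le>
        \<bar>M\<bar> * defect_const d c 1 1 (s + 1) * (h * H)"
    proof -
      have "fact (k + 1) * (d \<bullet> c ^ k) = fact k * 1 ^ (k + 1)" if "k < s + 1" for k
        using coll_d'[OF that] unfolding fact1 by simp
      from defect[OF this, where n = "s + 1" and j = 1 and z = t] t nodes
      show ?thesis by (simp add: X_def H_def numeral_2_eq_2 algebra_simps)
    qed
    have A_defect: "\<bar>g 0 (t + h + c $ i * h) - (g 0 (t + h) + c $ i * h * g 1 (t + h)) -
        h\<^sup>2 * (A $ i \<bullet> X)\<bar> \<le> \<bar>M\<bar> * defect_const (A $ i) (c - 1) (c $ i) 2 s * (h * H)" for i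
    proof -
      have "fact (k + 2) * (A $ i \<bullet> (c - 1) ^ k) = fact k * c $ i ^ (k + 2)" if "k < s" for k
        using coll_A[OF that, of i] unfolding fact2 by simp
      from defect[OF this, where n = s and j = 0 and z = "t + h"] t nodes
      show ?thesis by (simp add: shift X_def H_def numeral_2_eq_2 algebra_simps)
    qed
    have B_defect: "\<bar>g 1 (t + h + c $ i * h) - g 1 (t + h) - h * (B $ i \<bullet> X)\<bar> \<le>
        \<bar>M\<bar> * defect_const (B $ i) (c - 1) (c $ i) 1 s * H" for i
    proof -
      have "fact (k + 1) * (B $ i \<bullet> (c - 1) ^ k) = fact k * c $ i ^ (k + 1)" if "k < s" for k
        using coll_B[OF that, of i] unfolding fact1 by simp
      from defect[OF this, where n = s and j = 1 and z = "t + h"] t nodes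
      show ?thesis by (simp add: shift X_def H_def numeral_2_eq_2 algebra_simps)
    qed

    have h_F_err: "\<bar>h * (a \<bullet> (X - F))\<bar> \<le> norm a * E * (h * H)"
      and h2_F_err: "\<bar>h\<^sup>2 * (a \<bullet> (X - F))\<bar> \<le> norm a * E * (h * H)" for a :: "real^'s"
    proof -
      show 1: "\<bar>h * (a \<bullet> (X - F))\<bar> \<le> norm a * E * (h * H)"
        using mult_left_mono[OF weighted_F_err[of a], of h] h by (simp add: abs_mult mult_ac)
      have "\<bar>h\<^sup>2 * (a \<bullet> (X - F))\<bar> = h * \<bar>h * (a \<bullet> (X - F))\<bar>"
        using h by (simp add: abs_mult power2_eq_square)
      also have "\<dots> \<le> 1 * \<bar>h * (a \<bullet> (X - F))\<bar>"
        using h by (intro mult_right_mono) auto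
      finally show "\<bar>h\<^sup>2 * (a \<bullet> (X - F))\<bar> \<le> norm a * E * (h * H)"
        using 1 by simp
    qed

    have v_err: "\<bar>g 0 (t + h) - v\<bar> \<le> Kv * (h * H)"
    proof -
      have "g 0 (t + h) - v = (g 0 t - u) + h * (g 1 t - u') +
          (g 0 (t + h) - (g 0 t + h * g 1 t) - h\<^sup>2 * (b \<bullet> X)) + h\<^sup>2 * (b \<bullet> (X - F))"
        by (simp add: v_def inner_diff_right algebra_simps)
      moreover have "\<bar>h * (g 1 t - u')\<bar> \<le> \<bar>C\<bar> * (h * H)"
      proof -
        have "\<bar>h * (g 1 t - u')\<bar> \<le> 1 * \<bar>g 1 t - u'\<bar>"
          unfolding abs_mult using h by (intro mult_right_mono) auto
        with in_err(2) show ?thesis by simp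
      qed
      ultimately show ?thesis
        using in_err(1) b_defect h2_F_err[of b] unfolding Kv_def distrib_right by linarith
    qed
    have v'_err: "\<bar>g 1 (t + h) - v'\<bar> \<le> Kv' * (h * H)"
    proof -
      have "g 1 (t + h) - v' = (g 1 t - u') +
          (g 1 (t + h) - g 1 t - h * (d \<bullet> X)) + h * (d \<bullet> (X - F))"
        by (simp add: v'_def inner_diff_right algebra_simps)
      then show ?thesis
        using in_err(2) d_defect h_F_err[of d] unfolding Kv'_def distrib_right by linarith
    qed
    have V_err: "\<bar>g 0 (t + h + c $ i * h) - V $ i\<bar> \<le> KV i * H" for i
    proof -
      have "g 0 (t + h + c $ i * h) - V $ i = (g 0 (t + h) - v) + c $ i * h * (g 1 (t + h) - v') +
          (g 0 (t + h + c $ i * h) - (g 0 (t + h) + c $ i * h * g 1 (t + h)) - h\<^sup>2 * (A $ i \<bullet> X)) +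
          h\<^sup>2 * (A $ i \<bullet> (X - F))"
        by (simp add: V_def matrix_vector_mul_component inner_diff_right algebra_simps)
      moreover have "\<bar>c $ i * h * (g 1 (t + h) - v')\<bar> \<le> \<bar>c $ i\<bar> * Kv' * (h * H)"
      proof -
        have "\<bar>c $ i * h * (g 1 (t + h) - v')\<bar> \<le> \<bar>c $ i\<bar> * 1 * \<bar>g 1 (t + h) - v'\<bar>"
          unfolding abs_mult using h by (intro mult_right_mono mult_left_mono) auto
        also have "\<dots> \<le> \<bar>c $ i\<bar> * (Kv' * (h * H))"
          using v'_err by (simp add: mult_left_mono)
        finally show ?thesis by simp
      qed
      ultimately have "\<bar>g 0 (t + h + c $ i * h) - V $ i\<bar> \<le> KV i * (h * H)"
        using v_err A_defect[of i] h2_F_err[of "A $ i"] unfolding KV_def distrib_right by linarith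
      also have "\<dots> \<le> KV i * H"
        using hH(1) K_nonneg(3) by (rule mult_left_mono)
      finally show ?thesis .
    qed
    have V'_err: "\<bar>g 1 (t + h + c $ i * h) - V' $ i\<bar> \<le> KV' i * H" for i
    proof -
      have "g 1 (t + h + c $ i * h) - V' $ i = (g 1 (t + h) - v') +
          (g 1 (t + h + c $ i * h) - g 1 (t + h) - h * (B $ i \<bullet> X)) + h * (B $ i \<bullet> (X - F))"
        by (simp add: V'_def matrix_vector_mul_component inner_diff_right algebra_simps)
      moreover have "Kv' * (h * H) \<le> Kv' * H" "norm (B $ i) * E * (h * H) \<le> norm (B $ i) * E * H"
        using hH(1) K_nonneg(2) E by (auto intro!: mult_left_mono)
      ultimately show ?thesis
        using v'_err B_defect[of i] h_F_err[of "B $ i"] unfolding KV'_def distrib_right by linarith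
    qed

    have sums: "(\<Sum>i\<in>UNIV. KV i) \<ge> 0" "(\<Sum>i\<in>UNIV. KV' i) \<ge> 0"
      using K_nonneg by (auto intro: sum_nonneg)
    have K: "Kv \<le> K" "Kv' \<le> K" "(\<Sum>i\<in>UNIV. KV i) \<le> K" "(\<Sum>i\<in>UNIV. KV' i) \<le> K"
      using K_nonneg(1,2) sums unfolding K_def by linarith+
    have norm_err: "norm x \<le> K * H"
      if "\<And>i. \<bar>x $ i\<bar> \<le> k i * H" "(\<Sum>i\<in>UNIV. k i) \<le> K" for x :: "real^'s" and k
    proof -
      have "norm x \<le> (\<Sum>i\<in>UNIV. k i * H)"
        using norm_le_l1_cart[of x] sum_mono[of UNIV "\<lambda>i. \<bar>x $ i\<bar>" "\<lambda>i. k i * H"] that(1) by force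
      also have "\<dots> \<le> K * H"
        unfolding sum_distrib_right[symmetric] using that(2) H by (simp add: mult_right_mono)
      finally show ?thesis .
    qed
    have "\<bar>g 0 (t + h) - v\<bar> \<le> K * (h * H)" "\<bar>g 1 (t + h) - v'\<bar> \<le> K * (h * H)"
      using order.trans[OF v_err mult_right_mono[OF K(1)]] order.trans[OF v'_err mult_right_mono[OF K(2)]] h H
      by simp_all
    moreover have "norm ((\<chi> i. g 0 (t + h + c $ i * h)) - V) \<le> K * H"
      by (rule norm_err[OF _ K(3)]) (simp add: V_err)
    moreover have "norm ((\<chi> i. g 1 (t + h + c $ i * h)) - V') \<le> K * H"
      by (rule norm_err[OF _ K(4)]) (use V'_err in simp)
    ultimately show ?thesis
      unfolding step errors_le_def H_def by simp
  qed
  then show thesis by (rule that)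
qed

theorem theorem4p2:
  shows "\<exists>N. \<forall>(c :: real^'s) b d A B.
           inj (\<lambda>i. c $ i) \<and>
           integral {0..1} (\<lambda>\<xi>. \<Prod>i\<in>UNIV. \<xi> - c $ i) = 0 \<and>
           geptrkn_collocation c b d A B \<longrightarrow>
           geptrkn_step_order N c b d A B (CARD('s) + 1)"
proof (intro exI allI impI, elim conjE)
  \<comment> \<open>The deepest expansion is that of \<open>y'\<close> in the formula for \<open>d\<close>: its remainder of order \<open>s + 2\<close>
    involves the derivative of \<open>y\<close> of order \<open>s + 3\<close>.\<close>
  fix c b d :: "real^'s" and A B :: "real^'s^'s"
  let ?s = "CARD('s)"
  assume int: "integral {0..1} (\<lambda>\<xi>. \<Prod>i\<in>UNIV. \<xi> - c $ i) = 0"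
    and coll: "geptrkn_collocation c b d A B"
  have "real (k + 1) * (d \<bullet> c ^ k) = 1" if "k < ?s" for k
    using coll that unfolding geptrkn_collocation_def by metis
  then have extra: "real (?s + 1) * (d \<bullet> c ^ ?s) = 1"
    by (rule extra_moment_of_node_orthogonality[OF int])
  have one_step: "\<exists>K. \<forall>\<^sub>F h in at_right 0. \<forall>t w.
          {t, t + h} \<subseteq> {t0..t0 + T} \<and>
          (\<forall>i. {t + c $ i * h, t + h + c $ i * h} \<subseteq> {t0..t0 + T}) \<and>
          errors_le C (?s + 1) (?s + 1) ?s ?s c y y' h t w \<longrightarrow>
          errors_le K (?s + 1) (?s + 1) ?s ?s c y y' h (t + h) (geptrkn_step f c b d A B h t w)"
    if T: "T > 0" and f: "admissible_rhs (?s + 3) t0 T f" and sol: "solves_ivp t0 T f y0 y0' y y'"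
      and y: "Ck_on (?s + 3) y {t0..t0 + T}" for t0 T f y0 y0' y y' C
  proof -
    let ?S = "{t0..t0 + T}"
    obtain g where g0: "g 0 = y"
      and deriv: "\<And>j x. j < ?s + 3 \<Longrightarrow> x \<in> ?S \<Longrightarrow> (g j has_real_derivative g (Suc j) x) (at x within ?S)"
      and cont: "\<And>j. j \<le> ?s + 3 \<Longrightarrow> continuous_on ?S (g j)"
      using Ck_on_derivative_tower[OF y] by blast
    have y': "y' x = g 1 x" if "x \<in> ?S" for x
      using real_derivative_unique_within_interval[of t0 "t0 + T" x y "y' x" "g 1 x"]
        that T sol deriv[of 0 x] g0 by (auto simp: solves_ivp_def)
    have rhs: "g 2 x = f x (g 0 x) (g 1 x)" if "x \<in> ?S" for x
    proof -
      have "(y' has_real_derivative f x (y x) (y' x)) (at x within ?S)"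
        using sol that by (simp add: solves_ivp_def)
      then have "(g 1 has_real_derivative f x (g 0 x) (g 1 x)) (at x within ?S)"
        using that y' g0 has_field_derivative_transform_within[of y' _ x ?S 1 "g 1"] by simp
      moreover have "(g 1 has_real_derivative g 2 x) (at x within ?S)"
        using deriv[of 1 x] that by (simp add: numeral_2_eq_2)
      ultimately show ?thesis
        using real_derivative_unique_within_interval[of t0 "t0 + T" x "g 1"] that T by simp
    qed
    have "bounded (\<Union>j\<in>{..?s + 3}. g j ` ?S)"
      using cont by (intro bounded_UN ballI compact_imp_bounded compact_continuous_image) auto
    then obtain M where "\<forall>v\<in>(\<Union>j\<in>{..?s + 3}. g j ` ?S). norm v \<le> M"
      unfolding bounded_iff by blast
    then have M: "\<bar>g j x\<bar> \<le> M" if "j \<le> ?s + 3" "x \<in> ?S" for j x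
      using that by simp
    obtain L where L: "\<And>x. x \<in> ?S \<Longrightarrow> L-lipschitz_on UNIV (\<lambda>(u, v). f x u v)"
      using f unfolding admissible_rhs_def by blast
    obtain K where K: "\<And>h t w. \<lbrakk>0 < h; h \<le> 1; t \<in> ?S; t + h \<in> ?S;
        \<And>i. t + c $ i * h \<in> ?S; \<And>i. t + h + c $ i * h \<in> ?S;
        errors_le C (?s + 1) (?s + 1) ?s ?s c (g 0) (g 1) h t w\<rbrakk> \<Longrightarrow>
        errors_le K (?s + 1) (?s + 1) ?s ?s c (g 0) (g 1) h (t + h) (geptrkn_step f c b d A B h t w)"
      by (rule geptrkn_one_step_errors[OF coll extra convex_real_interval(5) deriv M rhs L, where C = C]) blast+
    have errors_y: "errors_le C' p1 p2 p3 p4 c y y' h t w = errors_le C' p1 p2 p3 p4 c (g 0) (g 1) h t w"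
      if "t \<in> ?S" "\<And>i. t + c $ i * h \<in> ?S" for C' p1 p2 p3 p4 h t w
      unfolding errors_le_def using that by (simp add: g0 y')
    have "\<forall>\<^sub>F h in at_right 0. 0 < h \<and> h \<le> (1::real)"
      unfolding eventually_at_right_field by (intro exI[of _ 1]) auto
    then have "\<forall>\<^sub>F h in at_right 0. \<forall>t w.
          {t, t + h} \<subseteq> ?S \<and> (\<forall>i. {t + c $ i * h, t + h + c $ i * h} \<subseteq> ?S) \<and>
          errors_le C (?s + 1) (?s + 1) ?s ?s c y y' h t w \<longrightarrow>
          errors_le K (?s + 1) (?s + 1) ?s ?s c y y' h (t + h) (geptrkn_step f c b d A B h t w)"
    proof (rule eventually_mono, intro allI impI, elim conjE)
      fix h t w
      assume h: "0 < h" "h \<le> 1" and t: "{t, t + h} \<subseteq> ?S"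
        and nodes: "\<forall>i. {t + c $ i * h, t + h + c $ i * h} \<subseteq> ?S"
        and err: "errors_le C (?s + 1) (?s + 1) ?s ?s c y y' h t w"
      have t': "t \<in> ?S" "t + h \<in> ?S" using t by blast+
      have nodes': "t + c $ i * h \<in> ?S" "t + h + c $ i * h \<in> ?S" for i using nodes by blast+
      have "errors_le C (?s + 1) (?s + 1) ?s ?s c (g 0) (g 1) h t w"
        using err errors_y[OF t'(1) nodes'(1)] by (rule iffD1[rotated])
      then have "errors_le K (?s + 1) (?s + 1) ?s ?s c (g 0) (g 1) h (t + h)
          (geptrkn_step f c b d A B h t w)"
        by (rule K[OF h t' nodes'])
      then show "errors_le K (?s + 1) (?s + 1) ?s ?s c y y' h (t + h)
          (geptrkn_step f c b d A B h t w)"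
        using errors_y[OF t'(2) nodes'(2)] by (rule iffD2[rotated])
    qed
    then show ?thesis by - (rule exI)
  qed
  show "geptrkn_step_order (?s + 3) c b d A B (?s + 1)"
    unfolding geptrkn_step_order_def
    by (rule exI[of _ "?s + 1"], rule exI[of _ "?s + 1"], rule exI[of _ ?s], rule exI[of _ ?s],
        intro conjI allI impI, simp, elim conjE) (rule one_step; assumption)
qed

end
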